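(* Let $(X,d)$ be a metric space, let $h\colon[0,\infty)\to[0,\infty)$ be a nondecreasing function with $h(t)>0$ for all $t>0$, and let $\mu\in\mathscr P(X)$ have compact and connected support. Then for all $0<r<\operatorname{diam}(\operatorname{supp}\mu)$ there exists $\nu\in\mathscr P(\operatorname{supp}\mu)$ such that $W_\infty(\mu,\nu)=r$ and $$\inf_{\lambda\in\Pi(\mu,\nu)}\int_{X\times X}h(d(x,y))\,\mathrm{d}\lambda(x,y)\ \le\ \tilde\omega(W_\infty(\mu,\nu)),$$ with $\tilde\omega(t)=m(t)h(t)$, where $m(t)=\inf_{x\in\operatorname{supp}\mu}\mu(B(x,t))$.
   Context: $\mathscr P(X)$ is the set of Borel probability measures on $X$. $\operatorname{supp}\mu$ is the support of $\mu$, i.e. the set of $x\in X$ with $\mu(B(x,r))>0$ for all $r>0$. $\mathscr P(\operatorname{supp}\mu)$ denotes the Borel probability measures living on $\operatorname{supp}\mu$. $B(x,r)$ is the open ball of center $x$ and radius $r$. $\Pi(\mu,\nu)$ is the set of Borel probability measures on $X\times X$ with first marginal $\mu$ and second marginal $\nu$. $W_\infty(\mu,\nu)=\inf_{\lambda\in\Pi(\mu,\nu)}\lambda\text{-}\operatorname{ess\,sup}_{(x,y)\in X^2}d(x,y)$, where $\lambda\text{-}\operatorname{ess\,sup}$ is the essential supremum with respect to $\lambda$.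
   Formalization: The formal theorem additionally assumes h(0)=0 (for constant h=1 the claim fails, since every coupling costs 1 while m(r)<1) and that μ gives full mass to its support, which is automatic on separable spaces but not provable for arbitrary metric spaces. *)

theory Defs
  imports "HOL-Probability.Probability"
begin

definition borel_probs :: "'a::topological_space measure set" where
  "borel_probs = {\<mu>. sets \<mu> = sets borel \<and> prob_space \<mu>}"

definition msupport :: "'a::metric_space measure \<Rightarrow> 'a set" where
  "msupport \<mu> = {x. \<forall>r>0. emeasure \<mu> (ball x r) > 0}"

text \<open>
  A Borel probability measure living on the closed set \<open>S\<close> is represented by a measure on the
  whole space giving full mass to \<open>S\<close>. On a non-separable space, \<open>\<mu> \<in> borel_probs_on (msupport \<mu>)\<close>
  is not provable for every \<open>\<mu> \<in> borel_probs\<close>: if there is a real-valued measurable cardinal, a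
  Borel probability measure on a discrete space may have empty support.
\<close>
definition borel_probs_on :: "'a::topological_space set \<Rightarrow> 'a measure set" where
  "borel_probs_on S = {\<mu> \<in> borel_probs. emeasure \<mu> S = 1}"

text \<open>
  On \<open>'a \<times> 'a\<close>, \<open>borel\<close> is the Borel algebra of the product topology. If \<open>'a\<close> is not separable, it
  can be strictly larger than the product algebra \<open>borel \<Otimes>\<^sub>M borel\<close>.
\<close>
definition couplings :: "'a::metric_space measure \<Rightarrow> 'a measure \<Rightarrow> ('a \<times> 'a) measure set" where
  "couplings \<mu> \<nu> = {\<pi> \<in> borel_probs. distr \<pi> borel fst = \<mu> \<and> distr \<pi> borel snd = \<nu>}"

definition W_infty :: "'a::metric_space measure \<Rightarrow> 'a measure \<Rightarrow> ennreal" where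
  "W_infty \<mu> \<nu> = (INF \<pi> \<in> couplings \<mu> \<nu>. esssup \<pi> (\<lambda>(x, y). ennreal (dist x y)))"

definition transport_cost ::
    "(real \<Rightarrow> real) \<Rightarrow> 'a::metric_space measure \<Rightarrow> 'a measure \<Rightarrow> ennreal" where
  "transport_cost h \<mu> \<nu> =
     (INF \<pi> \<in> couplings \<mu> \<nu>. \<integral>\<^sup>+ (x, y). ennreal (h (dist x y)) \<partial>\<pi>)"

definition min_ball_mass :: "'a::metric_space measure \<Rightarrow> real \<Rightarrow> real" where
  "min_ball_mass \<mu> t = (INF x \<in> msupport \<mu>. measure \<mu> (ball x t))"

definition omega_tilde :: "(real \<Rightarrow> real) \<Rightarrow> 'a::metric_space measure \<Rightarrow> real \<Rightarrow> real" where
  "omega_tilde h \<mu> t = min_ball_mass \<mu> t * h t"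

end

theory Submission
  imports Defs
begin

text \<open>
  Let \<open>x\<^sub>0\<close> be a point of the support at which the mass of the open ball of radius \<open>r\<close> is
  smallest; such a point exists by compactness, because \<open>x \<mapsto> \<mu> (B(x, r))\<close> is lower
  semicontinuous (lemma \<open>min_ball_mass_attained\<close>). The measure \<open>\<nu>\<close> arises from \<open>\<mu>\<close> by collapsing
  the ball \<open>B(x\<^sub>0, r)\<close> to its center and leaving everything else in place.

  The transport plan that performs this collapse moves only the mass \<open>\<mu> (B(x\<^sub>0, r)) = m(r)\<close>, and
  moves it by less than \<open>r\<close>. Its cost is therefore at most \<open>m(r) h(r)\<close>, and
  \<open>W\<^sub>\<infinity>(\<mu>, \<nu>) \<le> r\<close> (lemmas \<open>transport_cost_collapse_le\<close> and \<open>W_infty_collapse_le\<close>).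

  Conversely, suppose that some coupling moves no mass farther than \<open>s < r\<close>. The atom of
  \<open>\<nu>\<close> at \<open>x\<^sub>0\<close>, whose mass is at least \<open>\<mu> (B(x\<^sub>0, r))\<close>, would have to be fed from the closed ball
  of radius \<open>s\<close>, so the annulus between the radii \<open>s\<close> and \<open>r\<close> would be \<open>\<mu>\<close>-null. But the support
  is connected, contains \<open>x\<^sub>0\<close>, and is not contained in \<open>B(x\<^sub>0, r)\<close>, so it meets this open annulus,
  which must then have positive mass (lemma \<open>W_infty_collapse_ge\<close>). The support does leave
  \<open>B(x\<^sub>0, r)\<close>: as \<open>r\<close> is below the diameter, some ball of radius \<open>r\<close> centered in the support misses
  a neighbourhood of another point of the support and so has mass less than \<open>1\<close>; by minimality the
  same holds for the ball around \<open>x\<^sub>0\<close>.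
\<close>

section \<open>Mass of balls centered in the support\<close>

lemma open_meets_msupport_measure_pos:
  assumes "\<mu> \<in> borel_probs" "open U" "z \<in> U" "z \<in> msupport \<mu>"
  shows "measure \<mu> U > 0"
proof -
  interpret prob_space \<mu> using assms(1) by (simp add: borel_probs_def)
  have sets: "sets \<mu> = sets borel" using assms(1) by (simp add: borel_probs_def)
  obtain e where e: "e > 0" "ball z e \<subseteq> U"
    using assms(2,3) open_contains_ball by blast
  have "0 < measure \<mu> (ball z e)"
    using assms(4) e(1) by (auto simp: msupport_def emeasure_eq_measure)
  also have "\<dots> \<le> measure \<mu> U"
    using e(2) assms(2) by (intro finite_measure_mono) (auto simp: sets)
  finally show ?thesis .
qed

text \<open>
  Lower semicontinuity is used in the following form: the ball \<open>B(x, r)\<close> is exhausted by the balls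
  \<open>B(x, s)\<close> with \<open>s < r\<close>, and each of these is contained in \<open>B(y, r)\<close> for all \<open>y\<close> near \<open>x\<close>.
\<close>
lemma min_ball_mass_attained:
  fixes \<mu> :: "'a::metric_space measure"
  assumes mu: "\<mu> \<in> borel_probs" and compact: "compact (msupport \<mu>)"
    and nonempty: "msupport \<mu> \<noteq> {}"
  obtains x where "x \<in> msupport \<mu>" "measure \<mu> (ball x r) = min_ball_mass \<mu> r"
proof -
  interpret prob_space \<mu> using mu by (simp add: borel_probs_def)
  have sets: "sets \<mu> = sets borel" using mu by (simp add: borel_probs_def)
  define m where "m = min_ball_mass \<mu> r"
  have bdd: "bdd_below ((\<lambda>x. measure \<mu> (ball x r)) ` msupport \<mu>)"
    by (intro bdd_belowI[of _ 0]) auto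
  have "\<exists>x \<in> msupport \<mu>. measure \<mu> (ball x r) < m + 1 / real (Suc n)" for n
  proof -
    have "(INF x \<in> msupport \<mu>. measure \<mu> (ball x r)) < m + 1 / real (Suc n)"
      by (simp add: m_def min_ball_mass_def)
    thus ?thesis using cINF_less_iff[OF nonempty bdd] by blast
  qed
  then obtain f where f: "\<And>n. f n \<in> msupport \<mu>"
      "\<And>n. measure \<mu> (ball (f n) r) < m + 1 / real (Suc n)"
    by metis
  obtain x \<rho> where x: "x \<in> msupport \<mu>" "strict_mono \<rho>" "(f \<circ> \<rho>) \<longlonglongrightarrow> x"
    using compact f(1) unfolding compact_def by metis
  have bound: "measure \<mu> (ball x s) \<le> m" if "s < r" for s
  proof -
    have lim: "(\<lambda>n. m + 1 / real (Suc (\<rho> n))) \<longlonglongrightarrow> m + 0"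
      using LIMSEQ_subseq_LIMSEQ[OF LIMSEQ_Suc[OF lim_1_over_n] x(2)]
      by (intro tendsto_intros) (simp add: o_def)
    have "\<forall>\<^sub>F n in sequentially. dist ((f \<circ> \<rho>) n) x < r - s"
      using \<open>s < r\<close> by (intro tendstoD[OF x(3)]) simp
    hence "\<forall>\<^sub>F n in sequentially. measure \<mu> (ball x s) \<le> m + 1 / real (Suc (\<rho> n))"
    proof eventually_elim
      case (elim n)
      have "ball x s \<subseteq> ball (f (\<rho> n)) r"
      proof
        fix y assume "y \<in> ball x s"
        thus "y \<in> ball (f (\<rho> n)) r"
          using elim dist_triangle[of "f (\<rho> n)" y x] by auto
      qed
      hence "measure \<mu> (ball x s) \<le> measure \<mu> (ball (f (\<rho> n)) r)"
        by (intro finite_measure_mono) (auto simp: sets)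
      thus ?case using f(2)[of "\<rho> n"] by linarith
    qed
    from tendsto_lowerbound[OF lim this] show ?thesis by simp
  qed
  have union: "(\<Union>n. ball x (r - 1 / real (Suc n))) = ball x r"
  proof
    show "ball x r \<subseteq> (\<Union>n. ball x (r - 1 / real (Suc n)))"
    proof
      fix y assume "y \<in> ball x r"
      hence "0 < r - dist x y" by simp
      then obtain n where "1 / real (Suc n) < r - dist x y"
        using nat_approx_posE by blast
      thus "y \<in> (\<Union>n. ball x (r - 1 / real (Suc n)))" by (auto intro!: exI[of _ n])
    qed
    show "(\<Union>n. ball x (r - 1 / real (Suc n))) \<subseteq> ball x r"
      by (intro UN_least subset_ball) simp
  qed
  have "(\<lambda>n. measure \<mu> (ball x (r - 1 / real (Suc n)))) \<longlonglongrightarrow>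
          measure \<mu> (\<Union>n. ball x (r - 1 / real (Suc n)))"
    by (intro finite_Lim_measure_incseq incseq_SucI subset_ball)
       (auto simp: sets field_simps)
  hence "measure \<mu> (ball x r) \<le> m"
    unfolding union by (rule LIMSEQ_le_const2) (auto intro!: bound)
  moreover have "m \<le> measure \<mu> (ball x r)"
    unfolding m_def min_ball_mass_def by (rule cINF_lower[OF bdd x(1)])
  ultimately have "measure \<mu> (ball x r) = m" by (rule antisym)
  thus ?thesis using that[OF x(1)] unfolding m_def by blast
qed

section \<open>Collapsing a ball to its center\<close>

definition collapse :: "'a::metric_space \<Rightarrow> real \<Rightarrow> 'a \<Rightarrow> 'a" where
  "collapse c r x = (if x \<in> ball c r then c else x)"

definition collapse_plan :: "'a::metric_space measure \<Rightarrow> 'a \<Rightarrow> real \<Rightarrow> ('a \<times> 'a) measure" where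
  "collapse_plan \<mu> c r = distr \<mu> borel (\<lambda>x. (x, collapse c r x))"

text \<open>
  The target here is the Borel algebra of the product topology, so measurability of the two
  components need not suffice on a non-separable space. The map is instead glued from two
  continuous maps along a Borel set.
\<close>
lemma measurable_collapse_graph:
  fixes c :: "'a::metric_space"
  shows "(\<lambda>x. (x, collapse c r x)) \<in> borel_measurable borel"
proof -
  have "(\<lambda>x. if x \<in> ball c r then (x, c) else (x, x)) \<in> borel_measurable borel"
    by (intro measurable_If_set borel_measurable_continuous_onI continuous_intros) auto
  also have "(\<lambda>x. if x \<in> ball c r then (x, c) else (x, x)) = (\<lambda>x. (x, collapse c r x))"
    by (auto simp: collapse_def)
  finally show ?thesis .
qed

lemma measurable_fst_borel:
  "(fst :: 'a::topological_space \<times> 'b::topological_space \<Rightarrow> 'a) \<in> borel_measurable borel"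
  by (intro borel_measurable_continuous_onI continuous_intros)

lemma measurable_snd_borel:
  "(snd :: 'a::topological_space \<times> 'b::topological_space \<Rightarrow> 'b) \<in> borel_measurable borel"
  by (intro borel_measurable_continuous_onI continuous_intros)

lemma measurable_collapse:
  fixes c :: "'a::metric_space"
  shows "collapse c r \<in> borel_measurable borel"
  using measurable_compose[OF measurable_collapse_graph measurable_snd_borel, of c r] by simp

lemma measurable_dist_borel:
  "(\<lambda>(x, y). ennreal (dist x y)) \<in> borel_measurable (borel :: ('a::metric_space \<times> 'a) measure)"
  unfolding case_prod_beta
  by (intro measurable_compose[OF _ measurable_ennreal] borel_measurable_continuous_onI
      continuous_intros)

lemma collapse_plan_in_couplings:
  fixes \<mu> :: "'a::metric_space measure"
  assumes mu: "\<mu> \<in> borel_probs"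
  shows "collapse_plan \<mu> c r \<in> couplings \<mu> (distr \<mu> borel (collapse c r))"
proof -
  interpret prob_space \<mu> using mu by (simp add: borel_probs_def)
  have sets: "sets \<mu> = sets borel" using mu by (simp add: borel_probs_def)
  note meas = measurable_collapse_graph[of c r]
  have meas': "(\<lambda>x. (x, collapse c r x)) \<in> measurable \<mu> borel"
    using meas by (simp add: measurable_cong_sets[OF sets])
  have "prob_space (collapse_plan \<mu> c r)"
    unfolding collapse_plan_def by (rule prob_space_distr[OF meas'])
  moreover have "distr (collapse_plan \<mu> c r) borel fst = \<mu>"
    unfolding collapse_plan_def
    by (subst distr_distr[OF measurable_fst_borel meas']) (simp add: o_def distr_id2 sets)
  moreover have "distr (collapse_plan \<mu> c r) borel snd = distr \<mu> borel (collapse c r)"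
    unfolding collapse_plan_def
    by (subst distr_distr[OF measurable_snd_borel meas']) (simp add: o_def)
  ultimately show ?thesis
    by (simp add: couplings_def borel_probs_def collapse_plan_def)
qed

lemma dist_collapse_less: "0 < r \<Longrightarrow> dist x (collapse c r x) < r"
  by (simp add: collapse_def dist_commute)

lemma W_infty_collapse_le:
  fixes \<mu> :: "'a::metric_space measure"
  assumes mu: "\<mu> \<in> borel_probs" and r: "0 < r"
  shows "W_infty \<mu> (distr \<mu> borel (collapse c r)) \<le> ennreal r"
  unfolding W_infty_def
proof (rule INF_lower2[OF collapse_plan_in_couplings[OF mu]])
  have sets: "sets \<mu> = sets borel" using mu by (simp add: borel_probs_def)
  have meas: "(\<lambda>x. (x, collapse c r x)) \<in> measurable \<mu> borel"
    using measurable_collapse_graph[of c r] by (simp add: measurable_cong_sets[OF sets])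
  have "AE p in collapse_plan \<mu> c r. (\<lambda>(x, y). ennreal (dist x y)) p \<le> ennreal r"
    unfolding collapse_plan_def
  proof (subst AE_distr_iff[OF meas])
    show "{p \<in> space borel. (\<lambda>(x, y). ennreal (dist x y)) p \<le> ennreal r}
            \<in> sets (borel :: ('a \<times> 'a) measure)"
      using measurable_dist_borel by measurable
    show "AE x in \<mu>. (\<lambda>(x, y). ennreal (dist x y)) (x, collapse c r x) \<le> ennreal r"
      using less_imp_le[OF dist_collapse_less[OF r]] by (auto intro!: AE_I2 ennreal_leI)
  qed
  moreover have "(\<lambda>(x, y). ennreal (dist x y)) \<in> borel_measurable (collapse_plan \<mu> c r)"
    using measurable_dist_borel by (simp add: collapse_plan_def)
  ultimately show "esssup (collapse_plan \<mu> c r) (\<lambda>(x, y). ennreal (dist x y)) \<le> ennreal r"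
    by (intro esssup_I)
qed

text \<open>
  Points outside the ball stay put and contribute \<open>h 0 = 0\<close>; monotonicity bounds the contribution
  of every other point by \<open>h r\<close>.
\<close>
lemma transport_cost_collapse_le:
  fixes \<mu> :: "'a::metric_space measure"
  assumes mu: "\<mu> \<in> borel_probs" and r: "0 < r"
    and h_mono: "mono_on {0..} h" and h_zero: "h 0 = 0"
  shows "transport_cost h \<mu> (distr \<mu> borel (collapse c r))
           \<le> ennreal (measure \<mu> (ball c r) * h r)"
  unfolding transport_cost_def
proof (rule INF_lower2[OF collapse_plan_in_couplings[OF mu]])
  interpret prob_space \<mu> using mu by (simp add: borel_probs_def)
  have sets: "sets \<mu> = sets borel" using mu by (simp add: borel_probs_def)
  have meas: "(\<lambda>x. (x, collapse c r x)) \<in> measurable \<mu> borel"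
    using measurable_collapse_graph[of c r] by (simp add: measurable_cong_sets[OF sets])
  have ball_times: "ball c r \<times> UNIV \<in> sets (borel :: ('a \<times> 'a) measure)"
    by (intro borel_open open_Times) auto
  have closed: "closed ({p. fst p = snd p} :: ('a \<times> 'a) set)" "closed ({p. snd p = c} :: ('a \<times> 'a) set)"
    by (intro closed_Collect_eq continuous_intros)+
  \<comment> \<open>The integrand need not be Borel measurable, as \<open>h\<close> is arbitrary on the negative reals, so it
     is bounded pointwise on a Borel set \<open>R\<close> containing the graph of the collapse.\<close>
  define R :: "('a \<times> 'a) set"
    where "R = ((ball c r \<times> UNIV) \<inter> {p. snd p = c}) \<union> (- (ball c r \<times> UNIV) \<inter> {p. fst p = snd p})"
  have "R \<in> sets borel"
    unfolding R_def
    using closed[THEN borel_closed] ball_times by (intro sets.Un sets.Int borel_comp)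
  hence R_sets: "{p \<in> space borel. p \<in> R} \<in> sets borel"
    by simp
  have "AE p in collapse_plan \<mu> c r. p \<in> R"
    unfolding collapse_plan_def AE_distr_iff[OF meas R_sets]
    by (auto simp: R_def collapse_def)
  hence "(\<integral>\<^sup>+ (x, y). ennreal (h (dist x y)) \<partial>collapse_plan \<mu> c r)
          \<le> (\<integral>\<^sup>+ p. ennreal (h r) * indicator (ball c r \<times> UNIV) p \<partial>collapse_plan \<mu> c r)"
  proof (intro nn_integral_mono_AE, eventually_elim)
    case (elim p)
    have "h (dist (fst p) c) \<le> h r" if "fst p \<in> ball c r"
      using that r by (intro mono_onD[OF h_mono]) (auto simp: dist_commute)
    with elim show ?case
      by (cases p) (auto simp: R_def h_zero indicator_def intro!: ennreal_leI)
  qed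
  also have "\<dots> = ennreal (h r) * emeasure (collapse_plan \<mu> c r) (ball c r \<times> UNIV)"
    using ball_times by (intro nn_integral_cmult_indicator) (simp add: collapse_plan_def)
  also have "emeasure (collapse_plan \<mu> c r) (ball c r \<times> UNIV) = emeasure \<mu> (ball c r)"
  proof -
    have "(\<lambda>x. (x, collapse c r x)) -` (ball c r \<times> UNIV) \<inter> space \<mu> = ball c r"
      using sets_eq_imp_space_eq[OF sets] by auto
    thus ?thesis unfolding collapse_plan_def by (simp add: emeasure_distr[OF meas ball_times])
  qed
  also have "ennreal (h r) * emeasure \<mu> (ball c r) = ennreal (measure \<mu> (ball c r) * h r)"
    by (simp add: emeasure_eq_measure ennreal_mult'' mult.commute)
  finally show "(\<integral>\<^sup>+ (x, y). ennreal (h (dist x y)) \<partial>collapse_plan \<mu> c r)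
          \<le> ennreal (measure \<mu> (ball c r) * h r)" .
qed

lemma connected_meets_annulus:
  fixes S :: "'a::metric_space set"
  assumes "connected S" "c \<in> S" "y \<in> S" "r \<le> dist c y" "0 \<le> s" "s < r"
  obtains z where "z \<in> S" "s < dist c z" "dist c z < r"
proof -
  have conn: "connected (dist c ` S)"
    by (intro connected_continuous_image assms(1) continuous_intros)
  have "(s + r) / 2 \<in> dist c ` S"
    by (rule connectedD_interval[OF conn imageI[OF assms(2)] imageI[OF assms(3)]])
       (use assms(4-6) in simp_all)
  then obtain z where "z \<in> S" "dist c z = (s + r) / 2" by (metis imageE)
  thus ?thesis using that[of z] assms(6) by simp
qed

text \<open>
  A coupling under which almost every pair is at distance at most \<open>s\<close> gives \<open>\<nu> {c} \<le> \<mu> (cball c s)\<close>,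
  whereas the collapse puts at least the mass \<open>\<mu> (ball c r)\<close> on \<open>c\<close>. For \<open>s < r\<close> this
  contradicts the positive mass of the annulus between the two balls.
\<close>
lemma W_infty_collapse_ge:
  fixes \<mu> :: "'a::metric_space measure"
  assumes mu: "\<mu> \<in> borel_probs" and connected: "connected (msupport \<mu>)"
    and c: "c \<in> msupport \<mu>" and y: "y \<in> msupport \<mu>" "r \<le> dist c y"
  shows "ennreal r \<le> W_infty \<mu> (distr \<mu> borel (collapse c r))"
  unfolding W_infty_def
proof (rule INF_greatest, rule ccontr)
  interpret prob_space \<mu> using mu by (simp add: borel_probs_def)
  have sets: "sets \<mu> = sets borel" using mu by (simp add: borel_probs_def)
  define \<nu> where "\<nu> = distr \<mu> borel (collapse c r)"
  fix \<pi> assume \<pi>: "\<pi> \<in> couplings \<mu> (distr \<mu> borel (collapse c r))"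
    and "\<not> ennreal r \<le> esssup \<pi> (\<lambda>(x, y). ennreal (dist x y))"
  hence small: "esssup \<pi> (\<lambda>(x, y). ennreal (dist x y)) < ennreal r" by simp
  have \<pi>_sets: "sets \<pi> = sets borel" and marginals: "distr \<pi> borel fst = \<mu>" "distr \<pi> borel snd = \<nu>"
    using \<pi> by (auto simp: couplings_def borel_probs_def \<nu>_def)
  have fst_meas: "fst \<in> measurable \<pi> (borel :: 'a measure)"
    and snd_meas: "snd \<in> measurable \<pi> (borel :: 'a measure)"
    using measurable_fst_borel measurable_snd_borel by (simp_all add: measurable_cong_sets[OF \<pi>_sets])
  define s where "s = enn2real (esssup \<pi> (\<lambda>(x, y). ennreal (dist x y)))"
  have s_ennreal: "ennreal s = esssup \<pi> (\<lambda>(x, y). ennreal (dist x y))"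
    unfolding s_def using small by (intro ennreal_enn2real) (auto intro: less_trans)
  have "0 \<le> s" by (simp add: s_def)
  have "s < r" using small by (simp add: s_ennreal[symmetric] ennreal_less_iff \<open>0 \<le> s\<close>)
  have near: "AE p in \<pi>. dist (fst p) (snd p) \<le> s"
    using esssup_AE[of "\<lambda>(x, y). ennreal (dist x y)" \<pi>]
    by eventually_elim (auto simp: s_ennreal[symmetric] ennreal_le_iff \<open>0 \<le> s\<close> split: prod.splits)

  have "emeasure \<mu> (ball c r) \<le> emeasure \<nu> {c}"
  proof -
    have "ball c r \<subseteq> collapse c r -` {c} \<inter> space \<mu>"
      using sets_eq_imp_space_eq[OF sets] by (auto simp: collapse_def)
    moreover have "collapse c r \<in> measurable \<mu> borel"
      using measurable_collapse by (simp add: measurable_cong_sets[OF sets])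
    ultimately show ?thesis
      unfolding \<nu>_def by (simp add: emeasure_distr emeasure_mono measurable_sets)
  qed
  also have "\<dots> = emeasure \<pi> (snd -` {c} \<inter> space \<pi>)"
    unfolding marginals(2)[symmetric] by (intro emeasure_distr snd_meas) simp
  also have "\<dots> \<le> emeasure \<pi> (fst -` cball c s \<inter> space \<pi>)"
  proof (rule emeasure_mono_AE)
    show "AE p in \<pi>. p \<in> snd -` {c} \<inter> space \<pi> \<longrightarrow> p \<in> fst -` cball c s \<inter> space \<pi>"
      using near by eventually_elim (auto simp: dist_commute)
    show "fst -` cball c s \<inter> space \<pi> \<in> sets \<pi>"
      by (intro measurable_sets[OF fst_meas] borel_closed closed_cball)
  qed
  also have "\<dots> = emeasure \<mu> (cball c s)"
    unfolding marginals(1)[symmetric] by (intro emeasure_distr[symmetric] fst_meas) simp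
  finally have le: "measure \<mu> (ball c r) \<le> measure \<mu> (cball c s)"
    by (simp add: emeasure_eq_measure)

  obtain z where z: "z \<in> msupport \<mu>" "s < dist c z" "dist c z < r"
    using connected_meets_annulus[OF connected c y \<open>0 \<le> s\<close> \<open>s < r\<close>] by blast
  have "0 < measure \<mu> (ball c r - cball c s)"
    using z by (intro open_meets_msupport_measure_pos[OF mu, of _ z] open_Diff) auto
  also have "\<dots> = measure \<mu> (ball c r) - measure \<mu> (cball c s)"
    using \<open>s < r\<close> by (intro finite_measure_Diff) (auto simp: sets)
  finally show False using le by simp
qed

section \<open>A measure at prescribed distance\<close>

theorem proposition2p4:
  fixes \<mu> :: "'a::metric_space measure" and h :: "real \<Rightarrow> real" and r :: real
  assumes h_nonneg: "\<And>t. 0 \<le> t \<Longrightarrow> 0 \<le> h t"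
    and h_mono: "mono_on {0..} h"
    and h_pos: "\<And>t. 0 < t \<Longrightarrow> 0 < h t"
    and h_zero: "h 0 = 0"
    and mu: "\<mu> \<in> borel_probs"
    and mu_supp: "\<mu> \<in> borel_probs_on (msupport \<mu>)"
    and compact: "compact (msupport \<mu>)"
    and connected: "connected (msupport \<mu>)"
    and r: "0 < r" "r < diameter (msupport \<mu>)"
  shows "\<exists>\<nu> \<in> borel_probs_on (msupport \<mu>).
           W_infty \<mu> \<nu> = ennreal r \<and>
           transport_cost h \<mu> \<nu> \<le> ennreal (omega_tilde h \<mu> (enn2real (W_infty \<mu> \<nu>)))"
proof -
  interpret prob_space \<mu> using mu by (simp add: borel_probs_def)
  have sets: "sets \<mu> = sets borel" using mu by (simp add: borel_probs_def)
  have supp_sets: "msupport \<mu> \<in> sets borel"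
    using compact by (intro borel_closed compact_imp_closed)
  have supp_full: "measure \<mu> (msupport \<mu>) = 1"
    using mu_supp by (simp add: borel_probs_on_def emeasure_eq_measure)
  obtain x y where xy: "x \<in> msupport \<mu>" "y \<in> msupport \<mu>" "r < dist x y"
    using diameter_lower_bounded[OF compact_imp_bounded[OF compact], of r] r by blast
  obtain c where c: "c \<in> msupport \<mu>" "measure \<mu> (ball c r) = min_ball_mass \<mu> r"
    using min_ball_mass_attained[OF mu compact] xy(1) by blast

  \<comment> \<open>Minimality of the mass at \<open>c\<close> transfers to \<open>c\<close> what \<open>y\<close> shows for \<open>x\<close>: the ball of radius \<open>r\<close>
     does not carry all of the mass, so it cannot contain the support.\<close>
  obtain z where z: "z \<in> msupport \<mu>" "r \<le> dist c z"
  proof -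
    have "0 < measure \<mu> (- cball x r)"
      using xy by (intro open_meets_msupport_measure_pos[OF mu, of _ y]) auto
    also have "- cball x r = space \<mu> - cball x r"
      using sets_eq_imp_space_eq[OF sets] by auto
    also have "measure \<mu> (space \<mu> - cball x r) = 1 - measure \<mu> (cball x r)"
      by (intro prob_compl) (simp add: sets)
    finally have "measure \<mu> (cball x r) < 1" by simp
    moreover have "measure \<mu> (ball x r) \<le> measure \<mu> (cball x r)"
      by (intro finite_measure_mono) (auto simp: sets)
    moreover have "measure \<mu> (ball c r) \<le> measure \<mu> (ball x r)"
      unfolding c(2) min_ball_mass_def
      using xy(1) by (intro cINF_lower bdd_belowI[of _ 0]) auto
    ultimately have "measure \<mu> (ball c r) < measure \<mu> (msupport \<mu>)"
      using supp_full by linarith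
    hence "\<not> msupport \<mu> \<subseteq> ball c r"
      using finite_measure_mono[of "msupport \<mu>" "ball c r"] by (auto simp: sets)
    thus ?thesis using that by (meson mem_ball not_less subsetI)
  qed

  define \<nu> where "\<nu> = distr \<mu> borel (collapse c r)"
  have meas: "collapse c r \<in> measurable \<mu> borel"
    using measurable_collapse by (simp add: measurable_cong_sets[OF sets])
  have W: "W_infty \<mu> \<nu> = ennreal r"
    unfolding \<nu>_def
    using W_infty_collapse_le[OF mu r(1)] W_infty_collapse_ge[OF mu connected c(1) z]
    by (rule antisym)
  have "\<nu> \<in> borel_probs_on (msupport \<mu>)"
  proof -
    have prob: "prob_space \<nu>" unfolding \<nu>_def by (rule prob_space_distr[OF meas])
    have "msupport \<mu> \<subseteq> collapse c r -` msupport \<mu> \<inter> space \<mu>"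
      using c(1) sets_eq_imp_space_eq[OF sets] by (auto simp: collapse_def)
    hence "emeasure \<mu> (msupport \<mu>) \<le> emeasure \<nu> (msupport \<mu>)"
      unfolding \<nu>_def
      by (simp add: emeasure_distr[OF meas supp_sets] emeasure_mono
          measurable_sets[OF meas supp_sets])
    moreover have "emeasure \<nu> (msupport \<mu>) \<le> 1"
      by (rule subprob_space.subprob_emeasure_le_1[OF prob_space_imp_subprob_space[OF prob]])
    ultimately have "emeasure \<nu> (msupport \<mu>) = 1"
      using supp_full by (simp add: emeasure_eq_measure)
    thus ?thesis
      using prob by (simp add: borel_probs_on_def borel_probs_def \<nu>_def)
  qed
  moreover have "transport_cost h \<mu> \<nu> \<le> ennreal (omega_tilde h \<mu> (enn2real (W_infty \<mu> \<nu>)))"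
    using transport_cost_collapse_le[OF mu r(1) h_mono h_zero, of c] r(1)
    by (simp add: W omega_tilde_def c(2) flip: \<nu>_def)
  ultimately show ?thesis using W by blast
qed

end
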